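(* Let $(N,\langle\cdot,\cdot\rangle)$ be a $2$-step nilpotent Lie group endowed with a left-invariant metric, with Lie algebra $\mathfrak n=\mathfrak v\oplus\mathfrak z$ ($\mathfrak z$ the center, $\mathfrak v=\mathfrak z^\perp$), and let $TN$ denote its tangent bundle with the product metric. For a symmetric map $A:\mathfrak v\to\mathfrak v$ with respect to $\langle\cdot,\cdot\rangle_{\mathfrak v}$, let $g_A:TN\to\mathbb R$ be given by $$g_A(p,Y)=\tfrac12\langle Y,AY\rangle,$$ where $A$ is extended to $\mathfrak n$ by $AZ=0$ for all $Z\in\mathfrak z$. Then: (i) $g_A$ is a first integral of the geodesic flow if and only if for any basis $\{Z_1,\dots,Z_m\}$ of $\mathfrak z$ one has $[j(Z_i),A]=0$ for all $i=1,\dots,m$. (ii) Let $g_A$ and $g_B$ be a pair of such first integrals (with $A,B:\mathfrak v\to\mathfrak v$ symmetric) and $\{Z_1,\dots,Z_m\}$ a basis of $\mathfrak z$. Then $g_A$ and $g_B$ Poisson commute if and only if $j(Z_i)AB=j(Z_i)BA$ for all $i=1,\dots,m$. In particular, if $\mathfrak n$ is non-singular, then $\{g_A,g_B\}=0$ if and only if $[A,B]=0$.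
   Context: For $Z\in\mathfrak z$, $j(Z):\mathfrak v\to\mathfrak v$ is the skew-symmetric map defined by $\langle j(Z)U,V\rangle=\langle[U,V],Z\rangle$ for $U,V\in\mathfrak v$. A $2$-step nilpotent Lie algebra $\mathfrak n$ is non-singular if $\mathrm{ad}(X):\mathfrak n\to\mathfrak z$ is surjective for all $X\in\mathfrak n\setminus\mathfrak z$. For a Lie group $N$ with left-invariant metric and Lie algebra $\mathfrak n$: $TN$ is identified with $N\times\mathfrak n$, where $(p,Y)$ stands for $dL_p(Y)$, and $T_{(p,Y)}(TN)$ with $\mathfrak n\times\mathfrak n$, where $(U,V)$ is the initial velocity of $t\mapsto(p\exp(tU),Y+tV)$. The canonical symplectic form is $\Omega_{(p,Y)}((U,V),(U',V'))=\langle U,V'\rangle-\langle V,U'\rangle+\langle Y,[U,U']\rangle$. The Hamiltonian vector field $X_f$ is defined by $df=\Omega(X_f,\cdot)$, and $\{f,g\}=\Omega(X_f,X_g)$; $f$ and $g$ Poisson commute if $\{f,g\}=0$. The energy is $\mathrm E(p,Y)=\frac12\langle Y,Y\rangle$; its Hamiltonian flow is the geodesic flow, and $f$ is a first integral of the geodesic flow if $\{f,\mathrm E\}=0$. *)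

theory Defs
  imports "HOL-Analysis.Analysis"
begin

section \<open>Lie groups\<close>

text \<open>\<open>Ck_on k f S\<close> is meant for open \<open>S\<close> only: \<open>f\<close> is \<open>k\<close> times continuously
  differentiable on \<open>S\<close>.\<close>

primrec Ck_on ::
  "nat \<Rightarrow> ('a::euclidean_space \<Rightarrow> 'b::real_normed_vector) \<Rightarrow> 'a set \<Rightarrow> bool" where
  "Ck_on 0 f S \<longleftrightarrow> continuous_on S f"
| "Ck_on (Suc k) f S \<longleftrightarrow>
     (\<forall>x\<in>S. f differentiable (at x)) \<and> (\<forall>v. Ck_on k (\<lambda>x. frechet_derivative f (at x) v) S)"

definition smooth_on :: "('a::euclidean_space \<Rightarrow> 'b::real_normed_vector) \<Rightarrow> 'a set \<Rightarrow> bool" where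
  "smooth_on f S \<longleftrightarrow> (\<forall>k. Ck_on k f S)"

text \<open>A chart is a pair \<open>(U, \<phi>)\<close> of an open set and a homeomorphism of it onto an open subset of
  the model space.  The values of \<open>\<phi>\<close> outside \<open>U\<close> are irrelevant.\<close>

type_synonym ('g, 'e) chart = "'g set \<times> ('g \<Rightarrow> 'e)"

definition is_chart :: "('g::topological_space, 'e::euclidean_space) chart \<Rightarrow> bool" where
  "is_chart c \<longleftrightarrow> (case c of (U, \<phi>) \<Rightarrow>
     open U \<and> open (\<phi> ` U) \<and> homeomorphism U (\<phi> ` U) \<phi> (inv_into U \<phi>))"

definition smooth_atlas :: "('g::topological_space, 'e::euclidean_space) chart set \<Rightarrow> bool" where
  "smooth_atlas \<A> \<longleftrightarrow>
     (\<forall>c\<in>\<A>. is_chart c) \<and>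
     \<Union> (fst ` \<A>) = UNIV \<and>
     (\<forall>(U, \<phi>)\<in>\<A>. \<forall>(V, \<psi>)\<in>\<A>. smooth_on (\<psi> \<circ> inv_into U \<phi>) (\<phi> ` (U \<inter> V)))"

record ('g, 'e) lie_group_data =
  mult :: "'g \<Rightarrow> 'g \<Rightarrow> 'g"
  neutral :: 'g
  inversion :: "'g \<Rightarrow> 'g"
  atlas :: "('g, 'e) chart set"

definition lie_group ::
  "('g::{t2_space,second_countable_topology}, 'e::euclidean_space, 'r) lie_group_data_scheme
     \<Rightarrow> bool" where
  "lie_group N \<longleftrightarrow>
     group (mult N) (neutral N) (inversion N) \<and>
     smooth_atlas (atlas N) \<and>
     continuous_on UNIV (\<lambda>(p, q). mult N p q) \<and>
     continuous_on UNIV (inversion N) \<and>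
     (\<forall>(U, \<phi>)\<in>atlas N. \<forall>(V, \<psi>)\<in>atlas N. \<forall>(W, \<theta>)\<in>atlas N.
        smooth_on (\<lambda>(x, y). \<theta> (mult N (inv_into U \<phi> x) (inv_into V \<psi> y)))
          {(x, y). x \<in> \<phi> ` U \<and> y \<in> \<psi> ` V \<and> mult N (inv_into U \<phi> x) (inv_into V \<psi> y) \<in> W}) \<and>
     (\<forall>(U, \<phi>)\<in>atlas N. \<forall>(W, \<theta>)\<in>atlas N.
        smooth_on (\<lambda>x. \<theta> (inversion N (inv_into U \<phi> x)))
          {x \<in> \<phi> ` U. inversion N (inv_into U \<phi> x) \<in> W})"

definition smooth_fun ::
  "('g::topological_space, 'e::euclidean_space, 'r) lie_group_data_scheme
     \<Rightarrow> ('g \<Rightarrow> real) \<Rightarrow> bool" where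
  "smooth_fun N f \<longleftrightarrow> (\<forall>(U, \<phi>)\<in>atlas N. smooth_on (f \<circ> inv_into U \<phi>) (\<phi> ` U))"


section \<open>The Lie algebra and the exponential map\<close>

text \<open>Left-invariant vector fields, as derivations of the algebra of smooth functions.  The first
  condition makes the operator representing a given vector field unique.\<close>

definition left_invariant_fields ::
  "('g::topological_space, 'e::euclidean_space, 'r) lie_group_data_scheme
     \<Rightarrow> (('g \<Rightarrow> real) \<Rightarrow> 'g \<Rightarrow> real) set" where
  "left_invariant_fields N = {D.
     (\<forall>f. \<not> smooth_fun N f \<longrightarrow> D f = (\<lambda>p. 0)) \<and>
     (\<forall>f. smooth_fun N f \<longrightarrow> smooth_fun N (D f)) \<and>
     (\<forall>f g. smooth_fun N f \<longrightarrow> smooth_fun N g \<longrightarrow>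
        (\<forall>p. D (\<lambda>q. f q + g q) p = D f p + D g p)) \<and>
     (\<forall>c f. smooth_fun N f \<longrightarrow> (\<forall>p. D (\<lambda>q. c * f q) p = c * D f p)) \<and>
     (\<forall>f g. smooth_fun N f \<longrightarrow> smooth_fun N g \<longrightarrow>
        (\<forall>p. D (\<lambda>q. f q * g q) p = D f p * g p + f p * D g p)) \<and>
     (\<forall>a f. smooth_fun N f \<longrightarrow> (\<forall>p. D (\<lambda>q. f (mult N a q)) p = D f (mult N a p)))}"

text \<open>The Lie algebra is presented by a Euclidean space \<open>'n\<close> with a bracket and an isomorphism
  \<open>field\<close> of Lie algebras onto the left-invariant vector fields.  The left-invariant metric is the
  one for which \<open>\<langle>field X, field Y\<rangle>\<close> is constantly the inner product \<open>X \<bullet> Y\<close> of \<open>'n\<close>; as that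
  product is arbitrary, so is the metric.\<close>

record ('g, 'e, 'n) metric_lie_group = "('g, 'e) lie_group_data" +
  bracket :: "'n \<Rightarrow> 'n \<Rightarrow> 'n"
  field :: "'n \<Rightarrow> ('g \<Rightarrow> real) \<Rightarrow> 'g \<Rightarrow> real"

definition lie_bracket :: "('n::euclidean_space \<Rightarrow> 'n \<Rightarrow> 'n) \<Rightarrow> bool" where
  "lie_bracket br \<longleftrightarrow> bilinear br \<and> (\<forall>X. br X X = 0) \<and>
     (\<forall>X Y W. br X (br Y W) + br Y (br W X) + br W (br X Y) = 0)"

definition lie_group_with_left_invariant_metric ::
  "('g::{t2_space,second_countable_topology}, 'e::euclidean_space, 'n::euclidean_space)
     metric_lie_group \<Rightarrow> bool" where
  "lie_group_with_left_invariant_metric N \<longleftrightarrow>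
     lie_group N \<and>
     lie_bracket (bracket N) \<and>
     bij_betw (field N) UNIV (left_invariant_fields N) \<and>
     (\<forall>X Y f p. field N (X + Y) f p = field N X f p + field N Y f p) \<and>
     (\<forall>c X f p. field N (c *\<^sub>R X) f p = c * field N X f p) \<and>
     (\<forall>X Y f p. smooth_fun N f \<longrightarrow>
        field N (bracket N X Y) f p = field N X (field N Y f) p - field N Y (field N X f) p)"

definition is_integral_curve ::
  "('g::topological_space, 'e::euclidean_space, 'n) metric_lie_group
     \<Rightarrow> 'n \<Rightarrow> (real \<Rightarrow> 'g) \<Rightarrow> bool" where
  "is_integral_curve N X \<gamma> \<longleftrightarrow>
     (\<forall>f t. smooth_fun N f \<longrightarrow>
        ((\<lambda>s. f (\<gamma> s)) has_real_derivative field N X f (\<gamma> t)) (at t))"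

definition lie_exp ::
  "('g::topological_space, 'e::euclidean_space, 'n) metric_lie_group \<Rightarrow> 'n \<Rightarrow> 'g" where
  "lie_exp N X = (THE g. \<exists>\<gamma>. \<gamma> 0 = neutral N \<and> is_integral_curve N X \<gamma> \<and> g = \<gamma> 1)"


section \<open>Two-step nilpotent Lie algebras\<close>

text \<open>Abelian Lie algebras are not excluded.  It is the Lie algebra that is required to be
  nilpotent; \<open>N\<close> need be neither connected nor simply connected.\<close>

definition two_step_nilpotent ::
  "('g, 'e, 'n::euclidean_space) metric_lie_group \<Rightarrow> bool" where
  "two_step_nilpotent N \<longleftrightarrow> (\<forall>X Y W. bracket N (bracket N X Y) W = 0)"

definition center :: "('g, 'e, 'n::euclidean_space) metric_lie_group \<Rightarrow> 'n set" where
  "center N = {Z. \<forall>X. bracket N Z X = 0}"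

definition vpart :: "('g, 'e, 'n::euclidean_space) metric_lie_group \<Rightarrow> 'n set" where
  "vpart N = (center N)\<^sup>\<bottom>"

definition nonsingular :: "('g, 'e, 'n::euclidean_space) metric_lie_group \<Rightarrow> bool" where
  "nonsingular N \<longleftrightarrow> (\<forall>X. X \<notin> center N \<longrightarrow> range (bracket N X) = center N)"

text \<open>The maps \<open>j(Z)\<close> (for \<open>Z\<close> in the center) and \<open>A\<close> below are maps of \<open>vpart N\<close>; only their values
  on \<open>vpart N\<close> are meaningful, and all statements about them are restricted to it.\<close>

definition jmap ::
  "('g, 'e, 'n::euclidean_space) metric_lie_group \<Rightarrow> 'n \<Rightarrow> 'n \<Rightarrow> 'n" where
  "jmap N Z U = (THE W. W \<in> vpart N \<and> (\<forall>V\<in>vpart N. W \<bullet> V = bracket N U V \<bullet> Z))"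

definition symmetric_map_on :: "'n::euclidean_space set \<Rightarrow> ('n \<Rightarrow> 'n) \<Rightarrow> bool" where
  "symmetric_map_on S A \<longleftrightarrow>
     (\<forall>U\<in>S. A U \<in> S) \<and>
     (\<forall>U\<in>S. \<forall>V\<in>S. A (U + V) = A U + A V) \<and>
     (\<forall>c. \<forall>U\<in>S. A (c *\<^sub>R U) = c *\<^sub>R A U) \<and>
     (\<forall>U\<in>S. \<forall>V\<in>S. A U \<bullet> V = U \<bullet> A V)"

definition zero_extension ::
  "('g, 'e, 'n::euclidean_space) metric_lie_group \<Rightarrow> ('n \<Rightarrow> 'n) \<Rightarrow> 'n \<Rightarrow> 'n" where
  "zero_extension N A =
     (THE T. linear T \<and> (\<forall>U\<in>vpart N. T U = A U) \<and> (\<forall>Z\<in>center N. T Z = 0))"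

definition is_basis_of :: "'n::euclidean_space set \<Rightarrow> 'n set \<Rightarrow> bool" where
  "is_basis_of \<B> S \<longleftrightarrow> independent \<B> \<and> span \<B> = S"


section \<open>Symplectic geometry of the tangent bundle\<close>

text \<open>A point of \<open>TN\<close> is a pair \<open>(p, Y)\<close>, standing for the value at \<open>p\<close> of the left-invariant field
  \<open>Y\<close>; a tangent vector of \<open>TN\<close> there is a pair \<open>(U, V)\<close>, standing for the initial velocity of
  \<open>t \<mapsto> (p exp(tU), Y + tV)\<close>.\<close>

definition differential ::
  "('g::topological_space, 'e::euclidean_space, 'n::euclidean_space) metric_lie_group
     \<Rightarrow> ('g \<times> 'n \<Rightarrow> real) \<Rightarrow> 'g \<times> 'n \<Rightarrow> 'n \<times> 'n \<Rightarrow> real" where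
  "differential N f = (\<lambda>(p, Y) (U, V).
     deriv (\<lambda>t. f (mult N p (lie_exp N (t *\<^sub>R U)), Y + t *\<^sub>R V)) 0)"

definition symplectic_form ::
  "('g, 'e, 'n::euclidean_space) metric_lie_group
     \<Rightarrow> 'g \<times> 'n \<Rightarrow> 'n \<times> 'n \<Rightarrow> 'n \<times> 'n \<Rightarrow> real" where
  "symplectic_form N = (\<lambda>(p, Y) (U, V) (U', V'). U \<bullet> V' - V \<bullet> U' + Y \<bullet> bracket N U U')"

definition hamiltonian_field ::
  "('g::topological_space, 'e::euclidean_space, 'n::euclidean_space) metric_lie_group
     \<Rightarrow> ('g \<times> 'n \<Rightarrow> real) \<Rightarrow> 'g \<times> 'n \<Rightarrow> 'n \<times> 'n" where
  "hamiltonian_field N f x =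
     (THE \<xi>. \<forall>\<eta>. differential N f x \<eta> = symplectic_form N x \<xi> \<eta>)"

definition poisson_bracket ::
  "('g::topological_space, 'e::euclidean_space, 'n::euclidean_space) metric_lie_group
     \<Rightarrow> ('g \<times> 'n \<Rightarrow> real) \<Rightarrow> ('g \<times> 'n \<Rightarrow> real) \<Rightarrow> 'g \<times> 'n \<Rightarrow> real" where
  "poisson_bracket N f g x =
     symplectic_form N x (hamiltonian_field N f x) (hamiltonian_field N g x)"

definition poisson_commute ::
  "('g::topological_space, 'e::euclidean_space, 'n::euclidean_space) metric_lie_group
     \<Rightarrow> ('g \<times> 'n \<Rightarrow> real) \<Rightarrow> ('g \<times> 'n \<Rightarrow> real) \<Rightarrow> bool" where
  "poisson_commute N f g \<longleftrightarrow> (\<forall>x. poisson_bracket N f g x = 0)"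

definition energy :: "'g \<times> 'n::euclidean_space \<Rightarrow> real" where
  "energy = (\<lambda>(p, Y). 1 / 2 * (Y \<bullet> Y))"

definition first_integral ::
  "('g::topological_space, 'e::euclidean_space, 'n::euclidean_space) metric_lie_group
     \<Rightarrow> ('g \<times> 'n \<Rightarrow> real) \<Rightarrow> bool" where
  "first_integral N f \<longleftrightarrow> poisson_commute N f energy"

definition quadratic_fun ::
  "('g, 'e, 'n::euclidean_space) metric_lie_group \<Rightarrow> ('n \<Rightarrow> 'n) \<Rightarrow> 'g \<times> 'n \<Rightarrow> real" where
  "quadratic_fun N A = (\<lambda>(p, Y). 1 / 2 * (Y \<bullet> zero_extension N A Y))"

end

theory Submission
  imports Defs
begin

text \<open>On a function \<open>f (p, Y) = \<langle>Y, T Y\<rangle> / 2\<close> with \<open>T\<close> self-adjoint the \<open>N\<close>-direction drops out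
  of \<open>df\<close>, and the Hamiltonian field is \<open>(T Y, ad(T Y)\<^sup>t Y)\<close>.  Hence the functions of \<open>T\<close> and \<open>S\<close>
  have Poisson bracket \<open>\<langle>Y, [S Y, T Y]\<rangle>\<close>.  Writing \<open>Y = V + Z\<close> with \<open>V\<close> in \<open>v\<close> and \<open>Z\<close> central, the
  bracket of \<open>g\<^sub>A\<close> and \<open>g\<^sub>B\<close> becomes \<open>\<langle>j(Z) B V, A V\<rangle>\<close> and that of \<open>g\<^sub>A\<close> and \<open>E\<close> becomes
  \<open>\<langle>j(Z) V, A V\<rangle>\<close>.  By polarization these quadratic forms in \<open>V\<close> vanish iff
  \<open>A j(Z) B = B j(Z) A\<close> and \<open>A j(Z) = j(Z) A\<close>, respectively.  The last claim holds because an
  element of \<open>v\<close> annihilated by every \<open>j(Z)\<close> is central, hence zero.\<close>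

section \<open>Hamiltonian fields and Poisson brackets of quadratic functions\<close>

lemma differential_quadratic:
  assumes T: "linear T" and sa: "\<And>U V. T U \<bullet> V = U \<bullet> T V"
  shows "differential N (\<lambda>(p, Y). 1 / 2 * (Y \<bullet> T Y)) (p, Y) (U, V) = T Y \<bullet> V"
proof -
  have "(\<lambda>t. 1 / 2 * ((Y + t *\<^sub>R V) \<bullet> T (Y + t *\<^sub>R V)))
      = (\<lambda>t. 1 / 2 * (Y \<bullet> T Y) + t * (T Y \<bullet> V) + t\<^sup>2 / 2 * (V \<bullet> T V))"
  proof
    fix t
    \<comment> \<open>Self-adjointness makes the two cross terms equal, which absorbs the factor
      1/2. The derivative at 0 is then the linear coefficient of a polynomial in
      \<open>t\<close>.\<close>
    have "V \<bullet> T Y = T Y \<bullet> V" "Y \<bullet> T V = T Y \<bullet> V"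
      by (metis inner_commute sa)+
    then show "1 / 2 * ((Y + t *\<^sub>R V) \<bullet> T (Y + t *\<^sub>R V))
      = 1 / 2 * (Y \<bullet> T Y) + t * (T Y \<bullet> V) + t\<^sup>2 / 2 * (V \<bullet> T V)"
      by (simp add: linear_add[OF T] linear_scale[OF T] inner_add_left inner_add_right
          power2_eq_square algebra_simps)
  qed
  moreover have "((\<lambda>t. 1 / 2 * (Y \<bullet> T Y) + t * (T Y \<bullet> V) + t\<^sup>2 / 2 * (V \<bullet> T V))
      has_real_derivative T Y \<bullet> V) (at 0)"
    by (auto intro!: derivative_eq_intros)
  ultimately show ?thesis
    by (simp add: differential_def DERIV_imp_deriv)
qed

text \<open>The second component is the transpose of ad(T Y) applied to \<open>Y\<close>: its
  pairing with \<open>U\<close> cancels \<open>Y \<bullet> bracket N (T Y) U\<close> in the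
  symplectic form, leaving only \<open>T Y \<bullet> V\<close>. Uniqueness is the non-degeneracy of
  the form.\<close>

lemma hamiltonian_field_quadratic:
  assumes br: "bilinear (bracket N)" and T: "linear T" and sa: "\<And>U V. T U \<bullet> V = U \<bullet> T V"
  shows "hamiltonian_field N (\<lambda>(p, Y). 1 / 2 * (Y \<bullet> T Y)) (p, Y)
      = (T Y, adjoint (bracket N (T Y)) Y)"
  unfolding hamiltonian_field_def
proof (rule the_equality)
  have ad: "b \<bullet> adjoint (bracket N a) Y = bracket N a b \<bullet> Y" for a b
    using br by (auto simp: bilinear_def adjoint_works)
  show "\<forall>\<eta>. differential N (\<lambda>(p, Y). 1 / 2 * (Y \<bullet> T Y)) (p, Y) \<eta>
      = symplectic_form N (p, Y) (T Y, adjoint (bracket N (T Y)) Y) \<eta>"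
    unfolding split_paired_All differential_quadratic[OF T sa]
    by (simp add: symplectic_form_def inner_commute[of "adjoint _ _"] inner_commute[of Y] ad)
  fix \<xi> assume *: "\<forall>\<eta>. differential N (\<lambda>(p, Y). 1 / 2 * (Y \<bullet> T Y)) (p, Y) \<eta>
      = symplectic_form N (p, Y) \<xi> \<eta>"
  obtain a b where \<xi>: "\<xi> = (a, b)" by fastforce
  have **: "T Y \<bullet> V = a \<bullet> V - b \<bullet> U + Y \<bullet> bracket N a U" for U V
    using *[rule_format, of "(U, V)"]
    unfolding differential_quadratic[OF T sa] by (simp add: symplectic_form_def \<xi>)
  \<comment> \<open>The test vector \<open>(0, V)\<close> isolates the first component; then
    \<open>(U, 0)\<close> determines the second. Instantiations of \<open>**\<close> list
    \<open>V\<close> before \<open>U\<close>, in order of occurrence.\<close>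
  have "a \<bullet> V = T Y \<bullet> V" for V
    using **[of V 0] bilinear_rzero[OF br] by simp
  then have a: "a = T Y" by (rule iffD1[OF vector_eq_rdot, OF allI])
  have "U \<bullet> b = U \<bullet> adjoint (bracket N (T Y)) Y" for U
    using **[of 0 U] by (simp add: a ad inner_commute[of b] inner_commute[of Y])
  then have "b = adjoint (bracket N (T Y)) Y" by (rule iffD1[OF vector_eq_ldot, OF allI])
  with a \<xi> show "\<xi> = (T Y, adjoint (bracket N (T Y)) Y)" by simp
qed

text \<open>The term \<open>Y \<bullet> bracket N (T Y) (S Y)\<close> cancels against the second
  component of the field for \<open>T\<close> paired with \<open>S Y\<close>. What stays is
  \<open>T Y\<close> paired with the second component of the field for \<open>S\<close>.\<close>

lemma poisson_bracket_quadratic: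
  assumes br: "bilinear (bracket N)"
    and T: "linear T" and saT: "\<And>U V. T U \<bullet> V = U \<bullet> T V"
    and S: "linear S" and saS: "\<And>U V. S U \<bullet> V = U \<bullet> S V"
  shows "poisson_bracket N (\<lambda>(p, Y). 1 / 2 * (Y \<bullet> T Y)) (\<lambda>(p, Y). 1 / 2 * (Y \<bullet> S Y)) (p, Y)
      = Y \<bullet> bracket N (S Y) (T Y)"
proof -
  have ad: "b \<bullet> adjoint (bracket N a) Y = bracket N a b \<bullet> Y" for a b
    using br by (auto simp: bilinear_def adjoint_works)
  show ?thesis
    unfolding poisson_bracket_def hamiltonian_field_quadratic[OF br T saT]
      hamiltonian_field_quadratic[OF br S saS]
    by (simp add: symplectic_form_def inner_commute[of "adjoint _ _"] inner_commute[of "T Y"] ad)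
      (simp add: inner_commute)
qed

lemma symmetric_map_onD:
  assumes "symmetric_map_on S A" "U \<in> S"
  shows "A U \<in> S" "V \<in> S \<Longrightarrow> A (U + V) = A U + A V" "A (c *\<^sub>R U) = c *\<^sub>R A U"
    "V \<in> S \<Longrightarrow> A U \<bullet> V = U \<bullet> A V"
  using assms by (auto simp: symmetric_map_on_def)

section \<open>The orthogonal splitting of the Lie algebra into v and the center\<close>

locale two_step_metric =
  fixes N :: "('g::topological_space, 'e::euclidean_space, 'n::euclidean_space) metric_lie_group"
  assumes lie: "lie_bracket (bracket N)" and nilpotent: "two_step_nilpotent N"
begin

lemma bilinear: "bilinear (bracket N)"
  using lie by (simp add: lie_bracket_def)

lemmas bracket_simps = bilinear_ladd[OF bilinear] bilinear_radd[OF bilinear]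
  bilinear_lmul[OF bilinear] bilinear_rmul[OF bilinear]
  bilinear_lzero[OF bilinear] bilinear_rzero[OF bilinear]

lemma bracket_skew: "bracket N X Y = - bracket N Y X"
proof -
  have "bracket N W W = 0" for W using lie by (simp add: lie_bracket_def)
  from this[of "X + Y"] this[of X] this[of Y] show ?thesis
    by (simp add: bracket_simps add_eq_0_iff2)
qed

lemma bracket_center: "bracket N X Y \<in> center N"
  using nilpotent by (simp add: two_step_nilpotent_def center_def)

lemma bracket_center_left: "Z \<in> center N \<Longrightarrow> bracket N Z X = 0"
  by (simp add: center_def)

lemma bracket_center_right: "Z \<in> center N \<Longrightarrow> bracket N X Z = 0"
  using bracket_skew[of X Z] by (simp add: center_def)

lemma subspace_center: "subspace (center N)"
  by (auto simp: subspace_def center_def bracket_simps)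

lemma subspace_vpart: "subspace (vpart N)"
  by (simp add: vpart_def subspace_orthogonal_comp)

lemma vpart_inner_center:
  assumes "V \<in> vpart N" "Z \<in> center N" shows "V \<bullet> Z = 0" "Z \<bullet> V = 0"
  using assms by (auto simp: vpart_def orthogonal_comp_def orthogonal_def inner_commute)

lemma decomposition:
  obtains V Z where "V \<in> vpart N" "Z \<in> center N" "Y = V + Z"
proof -
  have "Y \<in> center N + vpart N"
    using subspace_sum_orthogonal_comp[OF subspace_center] by (simp add: vpart_def)
  then show ?thesis
    using that by (metis add.commute set_plus_elim)
qed

text \<open>The difference \<open>W - W'\<close> is itself an admissible test vector.\<close>

lemma vpart_eqI:
  assumes "W \<in> vpart N" "W' \<in> vpart N" and eq: "\<And>V. V \<in> vpart N \<Longrightarrow> W \<bullet> V = W' \<bullet> V"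
  shows "W = W'"
proof -
  have "W - W' \<in> vpart N" using assms subspace_vpart by (simp add: subspace_diff)
  from eq[OF this] have "(W - W') \<bullet> (W - W') = 0" by (simp add: inner_diff_left)
  then show ?thesis by simp
qed

lemma vpart_Int_center: "V \<in> vpart N \<Longrightarrow> V \<in> center N \<Longrightarrow> V = 0"
  using vpart_inner_center(1)[of V V] by simp

section \<open>The maps j(Z) on v\<close>

lemma jmap:
  assumes U: "U \<in> vpart N"
  shows jmap_in: "jmap N Z U \<in> vpart N"
    and jmap_inner: "V \<in> vpart N \<Longrightarrow> jmap N Z U \<bullet> V = bracket N U V \<bullet> Z"
proof -
  have ad: "V \<bullet> adjoint (bracket N U) Z = bracket N U V \<bullet> Z" for V
    using bilinear by (auto simp: bilinear_def adjoint_works)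
  \<comment> \<open>\<open>adjoint (bracket N U) Z\<close> represents the functional on the whole
    Lie algebra. Its central part \<open>C\<close> is orthogonal to v, so \<open>W\<close>
    represents the restriction to v.\<close>
  obtain W C where W: "W \<in> vpart N" "C \<in> center N" "adjoint (bracket N U) Z = W + C"
    by (rule decomposition)
  have WV: "W \<bullet> V = bracket N U V \<bullet> Z" if "V \<in> vpart N" for V
    using ad[of V] W vpart_inner_center[OF that W(2)] by (simp add: inner_add_right inner_commute)
  have "jmap N Z U \<in> vpart N \<and> (\<forall>V\<in>vpart N. jmap N Z U \<bullet> V = bracket N U V \<bullet> Z)"
    unfolding jmap_def
    by (rule theI[where a = W]) (use W(1) WV in \<open>auto intro: vpart_eqI\<close>)
  then show "jmap N Z U \<in> vpart N" "V \<in> vpart N \<Longrightarrow> jmap N Z U \<bullet> V = bracket N U V \<bullet> Z"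
    by auto
qed

lemma jmap_skew:
  assumes "U \<in> vpart N" "V \<in> vpart N"
  shows "jmap N Z U \<bullet> V = - (U \<bullet> jmap N Z V)"
  using jmap_inner[OF assms, of Z] jmap_inner[OF assms(2,1), of Z] bracket_skew[of U V]
  by (simp add: inner_commute)

lemma jmap_add_right:
  assumes "U \<in> vpart N" "V \<in> vpart N"
  shows "jmap N Z (U + V) = jmap N Z U + jmap N Z V"
  using assms subspace_vpart
  by (intro vpart_eqI)
     (auto simp: jmap_in jmap_inner subspace_add inner_add_left bracket_simps)

lemma jmap_diff_right:
  assumes "U \<in> vpart N" "V \<in> vpart N"
  shows "jmap N Z (U - V) = jmap N Z U - jmap N Z V"
  using jmap_add_right[of "U - V" V Z] assms subspace_vpart by (simp add: subspace_diff)

lemma jmap_add_left: "U \<in> vpart N \<Longrightarrow> jmap N (Z + Z') U = jmap N Z U + jmap N Z' U"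
  using subspace_vpart
  by (intro vpart_eqI) (auto simp: jmap_in jmap_inner subspace_add inner_add_left inner_add_right)

lemma jmap_scale_left: "U \<in> vpart N \<Longrightarrow> jmap N (c *\<^sub>R Z) U = c *\<^sub>R jmap N Z U"
  using subspace_vpart
  by (intro vpart_eqI) (auto simp: jmap_in jmap_inner subspace_scale)

lemma jmap_zero_left: "U \<in> vpart N \<Longrightarrow> jmap N 0 U = 0"
  using jmap_scale_left[of U 0 0] by simp

section \<open>Extension of symmetric maps by zero on the center\<close>

lemma zero_extension:
  assumes A: "symmetric_map_on (vpart N) A"
  shows linear_zero_extension: "linear (zero_extension N A)"
    and zero_extension_vpart: "V \<in> vpart N \<Longrightarrow> zero_extension N A V = A V"
    and zero_extension_center: "Z \<in> center N \<Longrightarrow> zero_extension N A Z = 0"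
proof -
  \<comment> \<open>\<open>P\<close> is the orthogonal projection onto v. As v meets the center only
    in 0, its values are determined (\<open>P_eq\<close>), which yields linearity. Composing
    \<open>A\<close> with \<open>P\<close> gives the extension.\<close>
  have "\<forall>Y. \<exists>V. V \<in> vpart N \<and> Y - V \<in> center N"
    by (metis decomposition add_diff_cancel_left')
  then obtain P where P: "\<And>Y. P Y \<in> vpart N" "\<And>Y. Y - P Y \<in> center N" by metis
  have P_eq: "P Y = V" if "V \<in> vpart N" "Y - V \<in> center N" for Y V
  proof -
    have "(Y - V) - (Y - P Y) \<in> center N"
      using that(2) P(2) subspace_center by (rule subspace_diff[rotated 1])
    then have "P Y - V \<in> center N" by simp
    moreover have "P Y - V \<in> vpart N" using that P subspace_vpart by (simp add: subspace_diff)
    ultimately show ?thesis using vpart_Int_center by fastforce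
  qed
  have "P (X + Y) = P X + P Y" for X Y
  proof (rule P_eq)
    have "(X - P X) + (Y - P Y) \<in> center N" by (intro subspace_add subspace_center P)
    then show "X + Y - (P X + P Y) \<in> center N" by (simp add: algebra_simps)
  qed (simp add: P subspace_add subspace_vpart)
  moreover have "P (c *\<^sub>R Y) = c *\<^sub>R P Y" for c Y
  proof (rule P_eq)
    have "c *\<^sub>R (Y - P Y) \<in> center N" by (intro subspace_scale subspace_center P)
    then show "c *\<^sub>R Y - c *\<^sub>R P Y \<in> center N" by (simp add: algebra_simps)
  qed (simp add: P subspace_scale subspace_vpart)
  ultimately have "linear (\<lambda>Y. A (P Y))"
    by (intro linearI) (simp_all add: symmetric_map_onD[OF A] P)
  moreover have "P V = V" if "V \<in> vpart N" for V
    using that subspace_center by (intro P_eq) (auto simp: subspace_0)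
  moreover have "A (P Z) = 0" if "Z \<in> center N" for Z
  proof -
    have "P Z = 0" using that subspace_vpart by (intro P_eq) (auto simp: subspace_0)
    \<comment> \<open>\<open>A\<close> is constrained only on v, so \<open>A 0 = 0\<close> is read
      off from homogeneity at the zero vector of v.\<close>
    then show ?thesis using symmetric_map_onD(3)[OF A, of 0 0] subspace_0[OF subspace_vpart] by simp
  qed
  ultimately have ex: "linear (\<lambda>Y. A (P Y)) \<and> (\<forall>U\<in>vpart N. A (P U) = A U)
      \<and> (\<forall>Z\<in>center N. A (P Z) = 0)"
    by auto
  have "linear (zero_extension N A) \<and> (\<forall>U\<in>vpart N. zero_extension N A U = A U)
      \<and> (\<forall>Z\<in>center N. zero_extension N A Z = 0)"
    unfolding zero_extension_def
  proof (rule theI[where a = "\<lambda>Y. A (P Y)"])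
    fix T assume T: "linear T \<and> (\<forall>U\<in>vpart N. T U = A U) \<and> (\<forall>Z\<in>center N. T Z = 0)"
    show "T = (\<lambda>Y. A (P Y))"
    proof
      fix Y
      have "T (P Y + (Y - P Y)) = T (P Y) + T (Y - P Y)" using T by (blast intro: linear_add)
      then show "T Y = A (P Y)" using T P by simp
    qed
  qed (rule ex)
  then show "linear (zero_extension N A)" "V \<in> vpart N \<Longrightarrow> zero_extension N A V = A V"
    "Z \<in> center N \<Longrightarrow> zero_extension N A Z = 0" by auto
qed

lemma zero_extension_add:
  assumes "symmetric_map_on (vpart N) A" "V \<in> vpart N" "Z \<in> center N"
  shows "zero_extension N A (V + Z) = A V"
  using assms by (simp add: linear_add[OF linear_zero_extension] zero_extension_vpart
      zero_extension_center)

text \<open>\<open>A\<close> takes values in v, which is orthogonal to the center, so both sides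
  reduce to pairings of v-components.\<close>

lemma zero_extension_selfadjoint:
  assumes A: "symmetric_map_on (vpart N) A"
  shows "zero_extension N A X \<bullet> Y = X \<bullet> zero_extension N A Y"
proof -
  obtain V Z where X: "V \<in> vpart N" "Z \<in> center N" "X = V + Z" by (rule decomposition)
  obtain V' Z' where Y: "V' \<in> vpart N" "Z' \<in> center N" "Y = V' + Z'" by (rule decomposition)
  show ?thesis
    using X Y A by (simp add: zero_extension_add inner_add_left inner_add_right
        vpart_inner_center symmetric_map_onD)
qed

section \<open>Poisson commutation in terms of j\<close>

lemma poisson_commute_iff:
  assumes A: "symmetric_map_on (vpart N) A" and B: "symmetric_map_on (vpart N) B"
  shows "poisson_commute N (quadratic_fun N A) (quadratic_fun N B) \<longleftrightarrow>
    (\<forall>Z\<in>center N. \<forall>V\<in>vpart N. jmap N Z (B V) \<bullet> A V = 0)"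
proof -
  \<comment> \<open>The bracket of \<open>B V\<close> and \<open>A V\<close> is central, hence
    orthogonal to \<open>V\<close>, so pairing it with \<open>V + Z\<close> sees only
    \<open>Z\<close>.\<close>
  have *: "poisson_bracket N (quadratic_fun N A) (quadratic_fun N B) (p, V + Z)
      = jmap N Z (B V) \<bullet> A V" if "V \<in> vpart N" "Z \<in> center N" for p V Z
    unfolding quadratic_fun_def poisson_bracket_quadratic[OF bilinear linear_zero_extension[OF A]
        zero_extension_selfadjoint[OF A] linear_zero_extension[OF B]
        zero_extension_selfadjoint[OF B]]
    using that A B
    by (simp add: zero_extension_add inner_add_left vpart_inner_center
        bracket_center jmap_inner symmetric_map_onD(1) inner_commute[of Z])
  show ?thesis
    unfolding poisson_commute_def
  proof (intro iffI ballI allI)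
    fix Z V assume "\<forall>x. poisson_bracket N (quadratic_fun N A) (quadratic_fun N B) x = 0"
      and "Z \<in> center N" "V \<in> vpart N"
    then show "jmap N Z (B V) \<bullet> A V = 0"
      using * by fastforce
  next
    fix x :: "'g \<times> 'n" assume 0: "\<forall>Z\<in>center N. \<forall>V\<in>vpart N. jmap N Z (B V) \<bullet> A V = 0"
    obtain p Y where x: "x = (p, Y)" by fastforce
    obtain V Z where "V \<in> vpart N" "Z \<in> center N" "Y = V + Z" by (rule decomposition)
    with 0 x show "poisson_bracket N (quadratic_fun N A) (quadratic_fun N B) x = 0"
      by (simp add: *)
  qed
qed

text \<open>The energy is the quadratic function of the identity of the whole Lie algebra, whereas
  the zero extension of the identity of v would lose the central directions; so this is not an
  instance of \<open>poisson_commute_iff\<close>. The additional term, the bracket of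
  \<open>Z\<close> with \<open>A V\<close>, vanishes because \<open>Z\<close> is central.\<close>

lemma first_integral_iff:
  assumes A: "symmetric_map_on (vpart N) A"
  shows "first_integral N (quadratic_fun N A) \<longleftrightarrow>
    (\<forall>Z\<in>center N. \<forall>V\<in>vpart N. jmap N Z V \<bullet> A V = 0)"
proof -
  have *: "poisson_bracket N (quadratic_fun N A) energy (p, V + Z)
      = jmap N Z V \<bullet> A V" if "V \<in> vpart N" "Z \<in> center N" for p V Z
    unfolding quadratic_fun_def energy_def
      poisson_bracket_quadratic[OF bilinear linear_zero_extension[OF A]
        zero_extension_selfadjoint[OF A] linear_ident refl]
    using that A
    by (simp add: zero_extension_add inner_add_left vpart_inner_center
        bracket_center bracket_center_left bracket_simps jmap_inner symmetric_map_onD(1)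
        inner_commute[of Z])
  show ?thesis
    unfolding first_integral_def poisson_commute_def
  proof (intro iffI ballI allI)
    fix Z V assume "\<forall>x. poisson_bracket N (quadratic_fun N A) energy x = 0"
      and "Z \<in> center N" "V \<in> vpart N"
    then show "jmap N Z V \<bullet> A V = 0"
      using * by fastforce
  next
    fix x :: "'g \<times> 'n" assume 0: "\<forall>Z\<in>center N. \<forall>V\<in>vpart N. jmap N Z V \<bullet> A V = 0"
    obtain p Y where x: "x = (p, Y)" by fastforce
    obtain V Z where "V \<in> vpart N" "Z \<in> center N" "Y = V + Z" by (rule decomposition)
    with 0 x show "poisson_bracket N (quadratic_fun N A) energy x = 0"
      by (simp add: *)
  qed
qed

text \<open>As j(Z) is skew and \<open>A\<close>, \<open>B\<close> are symmetric, the transpose of A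
  j(Z) B is - B j(Z) A. The quadratic form of A j(Z) B thus vanishes iff its symmetric part, half of
  A j(Z) B - B j(Z) A, does.\<close>

lemma quadratic_form_zero_iff:
  assumes A: "symmetric_map_on (vpart N) A" and B: "symmetric_map_on (vpart N) B"
  shows "(\<forall>V\<in>vpart N. jmap N Z (B V) \<bullet> A V = 0) \<longleftrightarrow>
    (\<forall>V\<in>vpart N. A (jmap N Z (B V)) = B (jmap N Z (A V)))"
proof -
  note A' = symmetric_map_onD[OF A] and B' = symmetric_map_onD[OF B]
  have flip: "jmap N Z (B W) \<bullet> A V = - (B (jmap N Z (A V)) \<bullet> W)"
    if "V \<in> vpart N" "W \<in> vpart N" for V W
  proof -
    have "jmap N Z (B W) \<bullet> A V = - (B W \<bullet> jmap N Z (A V))"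
      using that by (simp add: jmap_skew A'(1) B'(1))
    also have "B W \<bullet> jmap N Z (A V) = W \<bullet> B (jmap N Z (A V))"
      using that by (simp add: B'(4) A'(1) jmap_in)
    finally show ?thesis by (simp add: inner_commute)
  qed
  show ?thesis
  proof (intro iffI ballI)
    fix V assume 0: "\<forall>V\<in>vpart N. jmap N Z (B V) \<bullet> A V = 0" and V: "V \<in> vpart N"
    show "A (jmap N Z (B V)) = B (jmap N Z (A V))"
    proof (rule vpart_eqI)
      fix W assume W: "W \<in> vpart N"
      \<comment> \<open>Polarization: the form also vanishes at \<open>V\<close> and at
        \<open>W\<close>, so only the cross terms remain.\<close>
      have "jmap N Z (B (V + W)) \<bullet> A (V + W) = 0"
        using 0 V W subspace_vpart by (simp add: subspace_add)
      then have "jmap N Z (B V) \<bullet> A W + jmap N Z (B W) \<bullet> A V = 0"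
        using 0 V W by (simp add: A' B' jmap_add_right inner_add_left inner_add_right)
      then show "A (jmap N Z (B V)) \<bullet> W = B (jmap N Z (A V)) \<bullet> W"
        using flip[OF V W] V W by (simp add: A' B' jmap_in)
    qed (use V in \<open>simp_all add: A' B' jmap_in\<close>)
  next
    fix V assume "\<forall>V\<in>vpart N. A (jmap N Z (B V)) = B (jmap N Z (A V))" and V: "V \<in> vpart N"
    \<comment> \<open>By \<open>flip\<close> with both arguments \<open>V\<close>, these two numbers
      are negatives of each other; being equal, they are 0.\<close>
    then have "A (jmap N Z (B V)) \<bullet> V = B (jmap N Z (A V)) \<bullet> V" by simp
    then show "jmap N Z (B V) \<bullet> A V = 0"
      using flip[OF V V] V by (simp add: A' B' jmap_in)
  qed
qed

text \<open>On v the energy corresponds to the identity, so \<open>quadratic_form_zero_iff\<close>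
  applies for each \<open>Z\<close> with the identity as second map.\<close>

lemma first_integral_iff_commute:
  assumes A: "symmetric_map_on (vpart N) A"
  shows "first_integral N (quadratic_fun N A) \<longleftrightarrow>
    (\<forall>Z\<in>center N. \<forall>U\<in>vpart N. jmap N Z (A U) = A (jmap N Z U))"
proof -
  have "symmetric_map_on (vpart N) (\<lambda>Y. Y)" by (simp add: symmetric_map_on_def)
  from quadratic_form_zero_iff[OF A this]
  have "(\<forall>V\<in>vpart N. jmap N Z V \<bullet> A V = 0) \<longleftrightarrow>
      (\<forall>V\<in>vpart N. jmap N Z (A V) = A (jmap N Z V))" for Z
    by metis
  then show ?thesis
    by (simp add: first_integral_iff[OF A])
qed

text \<open>Being first integrals lets \<open>A\<close> and \<open>B\<close> move past j(Z), which
  turns A j(Z) B = B j(Z) A into j(Z) A B = j(Z) B A.\<close>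

lemma poisson_commute_iff_jmap:
  assumes A: "symmetric_map_on (vpart N) A" and B: "symmetric_map_on (vpart N) B"
    and "first_integral N (quadratic_fun N A)" "first_integral N (quadratic_fun N B)"
  shows "poisson_commute N (quadratic_fun N A) (quadratic_fun N B) \<longleftrightarrow>
    (\<forall>Z\<in>center N. \<forall>U\<in>vpart N. jmap N Z (A (B U)) = jmap N Z (B (A U)))"
proof -
  have "jmap N Z (A (B U)) = A (jmap N Z (B U))" "jmap N Z (B (A U)) = B (jmap N Z (A U))"
    if "Z \<in> center N" "U \<in> vpart N" for Z U
    using assms that symmetric_map_onD(1)[OF A] symmetric_map_onD(1)[OF B]
    by (auto simp: first_integral_iff_commute)
  then show ?thesis
    unfolding poisson_commute_iff[OF A B] quadratic_form_zero_iff[OF A B] by simp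
qed

section \<open>Vectors annihilated by all j(Z), and reduction to bases of the center\<close>

lemma jmap_eq_zero:
  assumes W: "W \<in> vpart N"
    and 0: "\<And>Z. Z \<in> center N \<Longrightarrow> jmap N Z W = 0"
  shows "W = 0"
proof (rule ccontr)
  assume "W \<noteq> 0"
  then have "W \<notin> center N" using W vpart_Int_center by blast
  then obtain X where X: "bracket N W X \<noteq> 0" by (auto simp: center_def)
  obtain V C where V: "V \<in> vpart N" "C \<in> center N" "X = V + C" by (rule decomposition)
  \<comment> \<open>The central element to test with is the bracket of \<open>W\<close> and
    \<open>V\<close> itself, which produces its squared norm.\<close>
  have "bracket N W V \<bullet> bracket N W V = 0"
    using jmap_inner[OF W V(1), of "bracket N W V"] 0[OF bracket_center] by simp
  then show False using X V by (simp add: bracket_simps bracket_center_right)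
qed

text \<open>A condition that cuts out a subspace passes from generators to their span; the
  conditions on \<open>Z\<close> below are of this kind because j(Z) is linear in
  \<open>Z\<close>.\<close>

lemma ball_basis_center:
  assumes \<B>: "is_basis_of \<B> (center N)"
    and sub: "subspace {Z. P Z}"
  shows "(\<forall>Z\<in>\<B>. P Z) \<longleftrightarrow> (\<forall>Z\<in>center N. P Z)"
  using \<B> span_minimal[OF _ sub, of \<B>] span_superset[of \<B>]
  by (auto simp: is_basis_of_def)

text \<open>Keeps the quantification over all bases in (i) from being vacuous: one basis suffices to
  recover the condition on the whole center.\<close>

lemma ex_basis_center: "\<exists>\<B>. is_basis_of \<B> (center N)"
  using basis_exists[of "center N"] span_minimal[OF _ subspace_center]
  by (metis is_basis_of_def subset_antisym)

lemma subspace_commute: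
  assumes A: "symmetric_map_on (vpart N) A"
  shows "subspace {Z. \<forall>U\<in>vpart N. jmap N Z (A U) = A (jmap N Z U)}"
  using symmetric_map_onD(3)[OF A, of 0 0] subspace_0[OF subspace_vpart]
  by (auto simp: subspace_def jmap_add_left jmap_scale_left jmap_zero_left jmap_in
      symmetric_map_onD[OF A])

lemma subspace_jmap_eq:
  assumes "\<And>U. U \<in> vpart N \<Longrightarrow> F U \<in> vpart N" "\<And>U. U \<in> vpart N \<Longrightarrow> G U \<in> vpart N"
  shows "subspace {Z. \<forall>U\<in>vpart N. jmap N Z (F U) = jmap N Z (G U)}"
  using assms by (auto simp: subspace_def jmap_add_left jmap_scale_left jmap_zero_left)

end

theorem theorem3p5:
  fixes N :: "('g::{t2_space,second_countable_topology}, 'e::euclidean_space, 'n::euclidean_space)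
    metric_lie_group"
  assumes "lie_group_with_left_invariant_metric N"
    and "two_step_nilpotent N"
  shows "(\<forall>A. symmetric_map_on (vpart N) A \<longrightarrow>
            (first_integral N (quadratic_fun N A) \<longleftrightarrow>
              (\<forall>\<B>. is_basis_of \<B> (center N) \<longrightarrow>
                 (\<forall>Z\<in>\<B>. \<forall>U\<in>vpart N. jmap N Z (A U) = A (jmap N Z U)))))
       \<and> (\<forall>A B. symmetric_map_on (vpart N) A \<longrightarrow> symmetric_map_on (vpart N) B \<longrightarrow>
            first_integral N (quadratic_fun N A) \<longrightarrow> first_integral N (quadratic_fun N B) \<longrightarrow>
            (\<forall>\<B>. is_basis_of \<B> (center N) \<longrightarrow>
               (poisson_commute N (quadratic_fun N A) (quadratic_fun N B) \<longleftrightarrow>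
                 (\<forall>Z\<in>\<B>. \<forall>U\<in>vpart N. jmap N Z (A (B U)) = jmap N Z (B (A U))))) \<and>
            (nonsingular N \<longrightarrow>
               (poisson_commute N (quadratic_fun N A) (quadratic_fun N B) \<longleftrightarrow>
                 (\<forall>U\<in>vpart N. A (B U) = B (A U)))))"
proof -
  interpret two_step_metric N
    using assms by unfold_locales (simp_all add: lie_group_with_left_invariant_metric_def)
  show ?thesis
  proof (intro conjI allI impI)
    fix A assume A: "symmetric_map_on (vpart N) A"
    show "first_integral N (quadratic_fun N A) \<longleftrightarrow>
        (\<forall>\<B>. is_basis_of \<B> (center N) \<longrightarrow>
           (\<forall>Z\<in>\<B>. \<forall>U\<in>vpart N. jmap N Z (A U) = A (jmap N Z U)))"
      using ball_basis_center[OF _ subspace_commute[OF A]] ex_basis_center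
      unfolding first_integral_iff_commute[OF A] by blast
  next
    fix A B \<B>
    assume A: "symmetric_map_on (vpart N) A" and B: "symmetric_map_on (vpart N) B"
      and int: "first_integral N (quadratic_fun N A)" "first_integral N (quadratic_fun N B)"
      and \<B>: "is_basis_of \<B> (center N)"
    have "subspace {Z. \<forall>U\<in>vpart N. jmap N Z (A (B U)) = jmap N Z (B (A U))}"
      using symmetric_map_onD(1)[OF A] symmetric_map_onD(1)[OF B] by (intro subspace_jmap_eq) auto
    from ball_basis_center[OF \<B> this]
    show "poisson_commute N (quadratic_fun N A) (quadratic_fun N B) \<longleftrightarrow>
        (\<forall>Z\<in>\<B>. \<forall>U\<in>vpart N. jmap N Z (A (B U)) = jmap N Z (B (A U)))"
      unfolding poisson_commute_iff_jmap[OF A B int] by blast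
  next
    fix A B
    assume A: "symmetric_map_on (vpart N) A" and B: "symmetric_map_on (vpart N) B"
      and int: "first_integral N (quadratic_fun N A)" "first_integral N (quadratic_fun N B)"
    have "A (B U) = B (A U)" if U: "U \<in> vpart N"
      and eq: "\<And>Z. Z \<in> center N \<Longrightarrow> jmap N Z (A (B U)) = jmap N Z (B (A U))" for U
    proof -
      have in_v: "A (B U) \<in> vpart N" "B (A U) \<in> vpart N"
        using U by (simp_all add: symmetric_map_onD(1)[OF A] symmetric_map_onD(1)[OF B])
      \<comment> \<open>The difference lies in v, and each j(Z) with \<open>Z\<close> central
        annihilates it by \<open>eq\<close>.\<close>
      have "A (B U) - B (A U) = 0"
        by (rule jmap_eq_zero)
           (use in_v in \<open>simp_all add: subspace_diff subspace_vpart jmap_diff_right eq\<close>)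
      then show ?thesis by simp
    qed
    then show "poisson_commute N (quadratic_fun N A) (quadratic_fun N B) \<longleftrightarrow>
        (\<forall>U\<in>vpart N. A (B U) = B (A U))"
      unfolding poisson_commute_iff_jmap[OF A B int] by auto
  qed
qed

end
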